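(* Let $r$, $m$, $n$ be positive integers with $m,n\ge 3$, let $G=K_m[P_n]$, and let $\delta$ and $\Delta$ denote the minimum and maximum degree of $G$. Then: (i) $\chi_r(G)=2m$ for $1\le r\le 2m-1$; (ii) $\chi_r(G)= r+2+\left\lfloor \frac{r-2m}{m-1}\right\rfloor$ for $2m\le r\le \delta$; (iii) $\chi_r(G)=mn$ for $r\ge \Delta$.
   Context: All graphs are finite, simple, undirected. An $r$-dynamic $k$-coloring of a graph $G$ is a map $c:V(G)\to\{1,\dots,k\}$ such that $c(u)\neq c(v)$ for every edge $uv$, and for every vertex $v$, $|c(N(v))|\ge \min\{r,d(v)\}$, where $N(v)$ is the set of neighbours of $v$ and $d(v)$ its degree. The $r$-dynamic chromatic number $\chi_r(G)$ is the least $k$ for which an $r$-dynamic $k$-coloring exists. $K_m$ is the complete graph on $m$ vertices and $P_n$ the path on $n$ vertices. The lexicographic product $G_1[G_2]$ has vertex set $V(G_1)\times V(G_2)$, with $(g,h)$ adjacent to $(g',h')$ iff $gg'\in E(G_1)$, or $g=g'$ and $hh'\in E(G_2)$. *)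

theory Defs
  imports Complex_Main "HOL-Library.FuncSet" "Graph_Theory.Graph_Theory"
begin

text \<open>
  A finite simple undirected graph is a \<^locale>\<open>pair_graph\<close>: finite, loopfree, with a symmetric
  arc relation, so the undirected edge \<open>uv\<close> is the pair of arcs \<open>(u,v)\<close>, \<open>(v,u)\<close>.
  Consequently the degree of a vertex is its \<^const>\<open>out_degree\<close>.
\<close>

definition neighborhood :: "'a pair_pre_digraph \<Rightarrow> 'a \<Rightarrow> 'a set" where
  "neighborhood G v = {u. (v, u) \<in> parcs G}"

lemma out_degree_eq_card_neighborhood:
  "out_degree (with_proj G) v = card (neighborhood G v)"
proof -
  have "out_arcs (with_proj G) v = Pair v ` neighborhood G v"
    by (auto simp: out_arcs_def neighborhood_def)
  then show ?thesis
    by (simp add: out_degree_def card_image inj_on_def)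
qed

definition min_degree :: "'a pair_pre_digraph \<Rightarrow> nat" where
  "min_degree G = Min (out_degree (with_proj G) ` pverts G)"

definition max_degree :: "'a pair_pre_digraph \<Rightarrow> nat" where
  "max_degree G = Max (out_degree (with_proj G) ` pverts G)"

definition dynamic_coloring ::
    "nat \<Rightarrow> nat \<Rightarrow> 'a pair_pre_digraph \<Rightarrow> ('a \<Rightarrow> nat) \<Rightarrow> bool" where
  "dynamic_coloring r k G c \<longleftrightarrow>
     c \<in> pverts G \<rightarrow> {1..k} \<and>
     (\<forall>(u, v) \<in> parcs G. c u \<noteq> c v) \<and>
     (\<forall>v \<in> pverts G. card (c ` neighborhood G v) \<ge> min r (out_degree (with_proj G) v))"

definition dynamic_chromatic_number :: "nat \<Rightarrow> 'a pair_pre_digraph \<Rightarrow> nat" where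
  "dynamic_chromatic_number r G = (LEAST k. \<exists>c. dynamic_coloring r k G c)"

definition complete_graph :: "nat \<Rightarrow> nat pair_pre_digraph" where
  "complete_graph m =
     \<lparr>pverts = {1..m}, parcs = {(i, j). i \<in> {1..m} \<and> j \<in> {1..m} \<and> i \<noteq> j}\<rparr>"

definition path_graph :: "nat \<Rightarrow> nat pair_pre_digraph" where
  "path_graph n =
     \<lparr>pverts = {1..n},
      parcs = {(i, j). i \<in> {1..n} \<and> j \<in> {1..n} \<and> (j = i + 1 \<or> i = j + 1)}\<rparr>"

definition lex_product ::
    "'a pair_pre_digraph \<Rightarrow> 'b pair_pre_digraph \<Rightarrow> ('a \<times> 'b) pair_pre_digraph" where
  "lex_product G1 G2 =
     \<lparr>pverts = pverts G1 \<times> pverts G2,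
      parcs = {((g, h), (g', h')).
        (g, h) \<in> pverts G1 \<times> pverts G2 \<and> (g', h') \<in> pverts G1 \<times> pverts G2 \<and>
        ((g, g') \<in> parcs G1 \<or> g = g' \<and> (h, h') \<in> parcs G2)}\<rparr>"

lemma pair_graphI:
  assumes "finite (pverts G)" and "parcs G \<subseteq> pverts G \<times> pverts G"
    and "sym (parcs G)" and "irrefl (parcs G)"
  shows "pair_graph G"
proof -
  have "finite (parcs G)"
    using assms(1,2) finite_subset by blast
  then show ?thesis
    using assms by unfold_locales (auto simp: symmetric_def irrefl_def)
qed

lemma complete_digraph_complete_graph: "complete_digraph m (with_proj (complete_graph m))"
  by (auto simp: complete_digraph_pair_def complete_graph_def)

lemma pair_graph_complete_graph: "pair_graph (complete_graph m)"
  by (rule pair_graphI_complete[OF complete_digraph_complete_graph])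

lemma pair_graph_path_graph: "pair_graph (path_graph n)"
  by (rule pair_graphI) (auto simp: path_graph_def sym_def irrefl_def)

lemma pair_graph_lex_product:
  assumes "pair_graph G1" and "pair_graph G2"
  shows "pair_graph (lex_product G1 G2)"
proof -
  interpret G1: pair_graph G1 by fact
  interpret G2: pair_graph G2 by fact
  show ?thesis
    by (rule pair_graphI)
      (auto simp: lex_product_def sym_def irrefl_def G1.pair_finite_verts G2.pair_finite_verts
        dest: G1.arcs_symmetric G2.arcs_symmetric G1.no_loops' G2.no_loops')
qed

text \<open>
  Every finite simple graph has an \<open>r\<close>-dynamic \<open>k\<close>-coloring for some \<open>k\<close> (color the vertices
  injectively), so the \<open>LEAST\<close> in \<^const>\<open>dynamic_chromatic_number\<close> is attained.
\<close>

lemma dynamic_coloring_exists: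
  assumes "pair_graph G"
  shows "\<exists>k c. dynamic_coloring r k G c"
proof -
  interpret pair_graph G by fact
  obtain c where c: "bij_betw c (pverts G) {1..card (pverts G)}"
    using pair_finite_verts finite_same_card_bij[of "pverts G" "{1..card (pverts G)}"] by auto
  have inj: "inj_on c (pverts G)" and im: "c ` pverts G = {1..card (pverts G)}"
    using c by (auto simp: bij_betw_def)
  have "card (c ` neighborhood G v) = card (neighborhood G v)" for v
    by (rule card_image, rule inj_on_subset[OF inj])
      (auto simp: neighborhood_def dest: in_arcsD2)
  moreover have "c u \<noteq> c v" if "(u, v) \<in> parcs G" for u v
    using that inj in_arcsD1 in_arcsD2 no_loops' by (metis inj_on_eq_iff)
  moreover have "c \<in> pverts G \<rightarrow> {1..card (pverts G)}"
    using im by blast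
  ultimately have "dynamic_coloring r (card (pverts G)) G c"
    unfolding dynamic_coloring_def out_degree_eq_card_neighborhood by auto
  then show ?thesis by blast
qed

end

theory Submission
  imports Defs
begin

text \<open>
  In a proper coloring of \<open>K\<^sub>m[P\<^sub>n]\<close> the \<open>m\<close> copies of \<open>P\<^sub>n\<close> use pairwise disjoint color sets, of sizes
  \<open>a\<^sub>1, \<dots>, a\<^sub>m \<in> {2..n}\<close> with sum \<open>S\<close>. An end vertex of the \<open>i\<close>-th copy sees exactly \<open>S - a\<^sub>i + 1\<close>
  colors and an inner vertex sees at least that many. So for \<open>r \<le> \<delta>\<close> the coloring is \<open>r\<close>-dynamic
  iff \<open>S - a\<^sub>i + 1 \<ge> r\<close> for all \<open>i\<close>, and \<open>\<chi>\<^sub>r\<close> is the least \<open>S\<close> for which such sizes exist; conversely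
  any sizes in \<open>{2..n}\<close> are realized by coloring each copy cyclically. If \<open>r \<ge> \<Delta>\<close>, every neighborhood
  is rainbow, and any two vertices are adjacent or have a common neighbor.
\<close>

section \<open>Splitting a number into bounded summands\<close>

text \<open>Start with every summand equal to \<open>l\<close> and raise the total by one at a time:
  as long as the total is below \<open>card I * u\<close>, some summand is below \<open>u\<close>
  and can be increased. This later supplies the sizes of the color sets.\<close>

lemma exists_bounded_summands:
  fixes l u K :: nat
  assumes "finite I" and "card I * l \<le> K" and "K \<le> card I * u"
  shows "\<exists>a. (\<forall>i\<in>I. l \<le> a i \<and> a i \<le> u) \<and> sum a I = K"
  using assms(2,3)
proof (induction K rule: dec_induct)
  case base
  show ?case
  proof (cases "I = {}")
    case False
    then have "l \<le> u" using base assms(1) by (simp add: card_gt_0_iff)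
    then show ?thesis by (intro exI[of _ "\<lambda>_. l"]) simp
  qed simp
next
  case (step K)
  then obtain a where a: "\<forall>i\<in>I. l \<le> a i \<and> a i \<le> u" "sum a I = K" by auto
  obtain i where i: "i \<in> I" "a i < u"
  proof (rule ccontr)
    assume "\<not> thesis"
    then have "\<forall>i\<in>I. u \<le> a i" using that by force
    then have "card I * u \<le> sum a I" by (metis sum_bounded_below of_nat_id)
    then show False using a(2) step.prems by simp
  qed
  have "sum (a(i := Suc (a i))) I = Suc (sum a I)"
    using assms(1) i(1) by (simp add: sum.remove[of I i])
  then show ?case
    using a i by (intro exI[of _ "a(i := Suc (a i))"]) auto
qed

section \<open>Neighborhoods and degrees in the product\<close>

lemma neighborhood_lex_product_complete_graph:
  assumes "pair_graph H" and "i \<in> {1..m}" and "h \<in> pverts H"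
  shows "neighborhood (lex_product (complete_graph m) H) (i, h) =
    ({1..m} - {i}) \<times> pverts H \<union> {i} \<times> neighborhood H h"
proof -
  interpret pair_graph H by fact
  show ?thesis
    using assms(2,3) in_arcsD2
    by (auto simp: neighborhood_def lex_product_def complete_graph_def)
qed

lemma neighborhood_path_graph_subset: "neighborhood (path_graph n) h \<subseteq> {1..n}"
  by (auto simp: neighborhood_def path_graph_def)

lemma neighborhood_path_graph_nonempty:
  assumes "n \<ge> 2" and "h \<in> {1..n}"
  shows "neighborhood (path_graph n) h \<noteq> {}"
proof (cases "h = n")
  case True
  then have "h - 1 \<in> neighborhood (path_graph n) h"
    using assms by (auto simp: neighborhood_def path_graph_def)
  then show ?thesis by blast
next
  case False
  then have "h + 1 \<in> neighborhood (path_graph n) h"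
    using assms by (auto simp: neighborhood_def path_graph_def)
  then show ?thesis by blast
qed

lemma neighborhood_path_graph_1: "n \<ge> 2 \<Longrightarrow> neighborhood (path_graph n) 1 = {2}"
  by (auto simp: neighborhood_def path_graph_def)

abbreviation (input) complete_lex_path :: "nat \<Rightarrow> nat \<Rightarrow> (nat \<times> nat) pair_pre_digraph" where
  "complete_lex_path m n \<equiv> lex_product (complete_graph m) (path_graph n)"

lemma pair_graph_complete_lex_path: "pair_graph (complete_lex_path m n)"
  by (intro pair_graph_lex_product pair_graph_complete_graph pair_graph_path_graph)

lemma pverts_complete_lex_path: "pverts (complete_lex_path m n) = {1..m} \<times> {1..n}"
  by (simp add: lex_product_def complete_graph_def path_graph_def)

lemma neighborhood_complete_lex_path:
  assumes "i \<in> {1..m}" and "h \<in> {1..n}"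
  shows "neighborhood (complete_lex_path m n) (i, h) =
    ({1..m} - {i}) \<times> {1..n} \<union> {i} \<times> neighborhood (path_graph n) h"
  using neighborhood_lex_product_complete_graph[OF pair_graph_path_graph assms(1), of h n] assms(2)
  by (simp add: path_graph_def)

lemma min_degree_le_out_degree:
  assumes "pair_graph G" and "v \<in> pverts G"
  shows "min_degree G \<le> out_degree (with_proj G) v"
proof -
  interpret pair_graph G by fact
  show ?thesis using assms(2) pair_finite_verts by (simp add: min_degree_def)
qed

lemma out_degree_le_max_degree:
  assumes "pair_graph G" and "v \<in> pverts G"
  shows "out_degree (with_proj G) v \<le> max_degree G"
proof -
  interpret pair_graph G by fact
  show ?thesis using assms(2) pair_finite_verts by (simp add: max_degree_def)
qed

text \<open>The bound is the degree of an end vertex of a copy. It turns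
  \<open>r \<le> \<delta>\<close> into an upper bound on \<open>r\<close> in terms of
  \<open>n\<close>, which ensures that a copy has enough vertices for the color set planned for
  it.\<close>

lemma min_degree_complete_lex_path_le:
  assumes "m \<ge> 1" and "n \<ge> 2"
  shows "min_degree (complete_lex_path m n) \<le> (m - 1) * n + 1"
proof -
  let ?G = "complete_lex_path m n"
  have "min_degree ?G \<le> out_degree (with_proj ?G) (1, 1)"
    using assms by (intro min_degree_le_out_degree pair_graph_complete_lex_path)
      (simp add: pverts_complete_lex_path)
  also have "\<dots> = card (({1..m} - {1}) \<times> {1..n} \<union> {1} \<times> {2})"
    using assms neighborhood_complete_lex_path[of 1 m 1 n] neighborhood_path_graph_1[of n]
    by (simp add: out_degree_eq_card_neighborhood)
  also have "\<dots> \<le> card (({1..m} - {1}) \<times> {1..n}) + card ({1::nat} \<times> {2::nat})"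
    by (rule card_Un_le)
  also have "\<dots> = (m - 1) * n + 1"
    using assms by (simp add: card_cartesian_product)
  finally show ?thesis .
qed

section \<open>Injective colorings and attained minima\<close>

lemma dynamic_coloring_card_verts_exists:
  assumes "pair_graph G"
  shows "\<exists>c. dynamic_coloring r (card (pverts G)) G c"
proof -
  interpret pair_graph G by fact
  obtain c where c: "bij_betw c (pverts G) {1..card (pverts G)}"
    using pair_finite_verts finite_same_card_bij[of "pverts G" "{1..card (pverts G)}"] by auto
  have inj: "inj_on c (pverts G)" and im: "c ` pverts G = {1..card (pverts G)}"
    using c by (auto simp: bij_betw_def)
  have "card (c ` neighborhood G v) = card (neighborhood G v)" for v
    by (rule card_image, rule inj_on_subset[OF inj])
      (auto simp: neighborhood_def dest: in_arcsD2)
  moreover have "c u \<noteq> c v" if "(u, v) \<in> parcs G" for u v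
    using that inj in_arcsD1 in_arcsD2 no_loops' by (metis inj_on_eq_iff)
  moreover have "c \<in> pverts G \<rightarrow> {1..card (pverts G)}"
    using im by blast
  ultimately show ?thesis
    unfolding dynamic_coloring_def out_degree_eq_card_neighborhood by auto
qed

lemma dynamic_chromatic_number_eqI:
  assumes "\<exists>c. dynamic_coloring r k G c"
    and "\<And>l c. dynamic_coloring r l G c \<Longrightarrow> k \<le> l"
  shows "dynamic_chromatic_number r G = k"
  unfolding dynamic_chromatic_number_def using assms by (intro Least_equality) auto

section \<open>Color sets of the copies of the path\<close>

text \<open>The cardinality of this set is the size \<open>a\<^sub>i\<close> of the
  overview.\<close>

definition layer_colors :: "nat \<Rightarrow> (nat \<times> nat \<Rightarrow> nat) \<Rightarrow> nat \<Rightarrow> nat set" where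
  "layer_colors n c i = c ` ({i} \<times> {1..n})"

lemma finite_layer_colors: "finite (layer_colors n c i)"
  by (simp add: layer_colors_def)

text \<open>A vertex is adjacent to all of every other copy, so each of those contributes its whole
  color set, and disjointness makes the counts add up. Only disjointness is assumed, so the formula
  serves both for a given coloring and for one under construction.\<close>

lemma card_layer_colors_image_neighborhood:
  assumes disj: "\<And>i j. i \<in> {1..m} \<Longrightarrow> j \<in> {1..m} \<Longrightarrow> i \<noteq> j \<Longrightarrow>
      layer_colors n c i \<inter> layer_colors n c j = {}"
    and "i \<in> {1..m}" and "h \<in> {1..n}"
  shows "card (c ` neighborhood (complete_lex_path m n) (i, h)) =
    (\<Sum>j\<in>{1..m} - {i}. card (layer_colors n c j)) +
    card (c ` ({i} \<times> neighborhood (path_graph n) h))"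
proof -
  let ?U = "\<Union>j\<in>{1..m} - {i}. layer_colors n c j"
  let ?N = "c ` ({i} \<times> neighborhood (path_graph n) h)"
  have "c ` neighborhood (complete_lex_path m n) (i, h) = ?U \<union> ?N"
    using assms(2,3) by (auto simp: neighborhood_complete_lex_path layer_colors_def)
  moreover have N: "?N \<subseteq> layer_colors n c i"
    using neighborhood_path_graph_subset unfolding layer_colors_def by blast
  have "?U \<inter> ?N = {}"
    using disj[OF assms(2)] N by fastforce
  moreover have "finite ?N"
    using N finite_layer_colors finite_subset by blast
  moreover have "card ?U = (\<Sum>j\<in>{1..m} - {i}. card (layer_colors n c j))"
    using disj by (intro card_UN_disjoint) (auto simp: finite_layer_colors)
  ultimately show ?thesis
    by (simp add: card_Un_disjoint finite_layer_colors)
qed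

lemma proper_layer_colors_disjoint:
  assumes "\<forall>(u, v) \<in> parcs (complete_lex_path m n). c u \<noteq> c v"
    and "i \<in> {1..m}" and "j \<in> {1..m}" and "i \<noteq> j"
  shows "layer_colors n c i \<inter> layer_colors n c j = {}"
proof -
  have "c (i, h) \<noteq> c (j, h')" if "h \<in> {1..n}" "h' \<in> {1..n}" for h h'
  proof -
    have "((i, h), (j, h')) \<in> parcs (complete_lex_path m n)"
      using assms(2-) that by (auto simp: lex_product_def complete_graph_def path_graph_def)
    then show ?thesis using assms(1) by blast
  qed
  then show ?thesis by (auto simp: layer_colors_def)
qed

lemma dynamic_coloring_sum_layer_colors_le:
  assumes "dynamic_coloring r k (complete_lex_path m n) c"
  shows "(\<Sum>i\<in>{1..m}. card (layer_colors n c i)) \<le> k"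
proof -
  have "(\<Sum>i\<in>{1..m}. card (layer_colors n c i)) = card (\<Union>i\<in>{1..m}. layer_colors n c i)"
    using assms proper_layer_colors_disjoint[of m n c] finite_layer_colors
    unfolding dynamic_coloring_def by (intro card_UN_disjoint[symmetric]) auto
  also have "\<dots> \<le> card {1..k}"
    using assms by (intro card_mono)
      (auto simp: dynamic_coloring_def pverts_complete_lex_path layer_colors_def Pi_iff)
  finally show ?thesis by simp
qed

lemma dynamic_coloring_two_le_layer_colors:
  assumes "dynamic_coloring r k (complete_lex_path m n) c" and "n \<ge> 2" and "i \<in> {1..m}"
  shows "2 \<le> card (layer_colors n c i)"
proof -
  have "((i, 1), (i, 2)) \<in> parcs (complete_lex_path m n)"
    using assms(2,3) by (auto simp: lex_product_def complete_graph_def path_graph_def)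
  then have "c (i, 1) \<noteq> c (i, 2)"
    using assms(1) unfolding dynamic_coloring_def by blast
  then have "card {c (i, 1), c (i, 2)} = 2" by simp
  moreover have "{c (i, 1), c (i, 2)} \<subseteq> layer_colors n c i"
    using assms(2) by (auto simp: layer_colors_def)
  ultimately show ?thesis
    by (metis card_mono finite_layer_colors)
qed

text \<open>The end vertex \<open>(i, 1)\<close> has a single neighbor in its own copy, hence sees
  just one color besides those of the other copies. As \<open>r \<le> \<delta>\<close>, it must see
  at least \<open>r\<close> colors.\<close>

lemma dynamic_coloring_le_sum_other_layers:
  assumes "dynamic_coloring r k (complete_lex_path m n) c" and "n \<ge> 2" and "i \<in> {1..m}"
    and "r \<le> min_degree (complete_lex_path m n)"
  shows "r \<le> (\<Sum>j\<in>{1..m} - {i}. card (layer_colors n c j)) + 1"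
proof -
  let ?G = "complete_lex_path m n"
  have v: "(i, 1) \<in> pverts ?G"
    using assms(2,3) by (simp add: pverts_complete_lex_path)
  have "r \<le> out_degree (with_proj ?G) (i, 1)"
    using min_degree_le_out_degree[OF pair_graph_complete_lex_path v] assms(4) by simp
  then have "r \<le> card (c ` neighborhood ?G (i, 1))"
    using assms(1) v unfolding dynamic_coloring_def by fastforce
  also have "\<dots> = (\<Sum>j\<in>{1..m} - {i}. card (layer_colors n c j)) + card (c ` ({i} \<times> {2}))"
    using assms proper_layer_colors_disjoint[of m n c] neighborhood_path_graph_1[of n]
    by (subst card_layer_colors_image_neighborhood) (auto simp: dynamic_coloring_def)
  finally show ?thesis by simp
qed

section \<open>Coloring with prescribed sizes\<close>

lemma dynamic_coloring_with_layer_sizes_exists: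
  fixes a :: "nat \<Rightarrow> nat"
  assumes a: "\<And>i. i \<in> {1..m} \<Longrightarrow> 2 \<le> a i \<and> a i \<le> n"
    and r: "\<And>i. i \<in> {1..m} \<Longrightarrow> r \<le> (\<Sum>j\<in>{1..m} - {i}. a j) + 1"
    and n: "n \<ge> 2"
  shows "\<exists>c. dynamic_coloring r (\<Sum>i\<in>{1..m}. a i) (complete_lex_path m n) c"
proof -
  \<comment> \<open>Copy \<open>i\<close> receives the block of \<open>a i\<close> consecutive
    colors following the \<open>s i\<close> colors of the earlier copies, and runs through it
    cyclically. The \<open>Suc\<close> and the \<open>h - 1\<close> are there because colors and
    path vertices are numbered from 1.\<close>
  define s where "s i = (\<Sum>j\<in>{1..<i}. a j)" for i
  define c where "c = (\<lambda>(i, h). Suc (s i + (h - 1) mod a i))"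
  have s_Suc: "s (Suc i) = s i + a i" if "1 \<le> i" for i
    using that by (simp add: s_def)
  have s_mono: "s i \<le> s j" if "i \<le> j" for i j
    unfolding s_def using that by (intro sum_mono2) auto
  have total: "s (Suc m) = (\<Sum>i\<in>{1..m}. a i)"
    by (simp add: s_def atLeastLessThanSuc_atLeastAtMost)
  have layer: "layer_colors n c i = {s i <.. s i + a i}" if i: "i \<in> {1..m}" for i
  proof (intro equalityI subsetI)
    fix x assume "x \<in> layer_colors n c i"
    then obtain h where "x = Suc (s i + (h - 1) mod a i)"
      by (auto simp: layer_colors_def c_def)
    moreover have "(h - 1) mod a i < a i" using a[OF i] by simp
    ultimately show "x \<in> {s i <.. s i + a i}" by simp
  next
    fix x assume x: "x \<in> {s i <.. s i + a i}"
    \<comment> \<open>The first \<open>a i\<close> vertices of the copy already run through the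
      whole block; they exist because \<open>a i \<le> n\<close>.\<close>
    then have "x = c (i, x - s i)"
      by (auto simp: c_def)
    moreover have "x - s i \<in> {1..n}" using x a[OF i] by auto
    ultimately show "x \<in> layer_colors n c i" unfolding layer_colors_def by blast
  qed
  have less: "x < y" if "x \<in> layer_colors n c i" "y \<in> layer_colors n c j"
    "i \<in> {1..m}" "j \<in> {1..m}" "i < j" for x y i j
    using that s_mono[of "Suc i" j] s_Suc[of i] by (auto simp: layer)
  have disj: "layer_colors n c i \<inter> layer_colors n c j = {}"
    if "i \<in> {1..m}" "j \<in> {1..m}" "i \<noteq> j" for i j
    using that less[of _ i _ j] less[of _ j _ i] by (cases "i < j") fastforce+
  \<comment> \<open>Consecutive numbers differ modulo \<open>a i\<close> since
    \<open>a i \<ge> 2\<close>.\<close>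
  have path_proper: "c (i, h) \<noteq> c (i, Suc h)" if "i \<in> {1..m}" "h \<ge> 1" for i h
  proof
    assume "c (i, h) = c (i, Suc h)"
    then have "(h - 1) mod a i = (Suc (h - 1)) mod a i"
      using that by (simp add: c_def)
    then show False using a[OF that(1)] by (metis mod_Suc n_not_Suc_n not_numeral_le_zero
          One_nat_def Suc_1 Suc_n_not_le_n)
  qed
  have "c \<in> pverts (complete_lex_path m n) \<rightarrow> {1..\<Sum>i\<in>{1..m}. a i}"
  proof
    fix v assume "v \<in> pverts (complete_lex_path m n)"
    then obtain i h where v: "v = (i, h)" "i \<in> {1..m}" "h \<in> {1..n}"
      by (auto simp: pverts_complete_lex_path)
    then have "c v \<in> layer_colors n c i" by (simp add: layer_colors_def)
    then show "c v \<in> {1..\<Sum>i\<in>{1..m}. a i}"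
      using v s_mono[of "Suc i" "Suc m"] s_Suc[of i] total by (auto simp: layer)
  qed
  moreover have "c u \<noteq> c v" if uv: "(u, v) \<in> parcs (complete_lex_path m n)" for u v
  proof -
    obtain i h j h' where *: "u = (i, h)" "v = (j, h')" "i \<in> {1..m}" "j \<in> {1..m}"
      "h \<in> {1..n}" "h' \<in> {1..n}" "i \<noteq> j \<or> i = j \<and> (h' = Suc h \<or> h = Suc h')"
      using uv by (auto simp: lex_product_def complete_graph_def path_graph_def)
    show ?thesis
    proof (cases "i = j")
      case True
      then show ?thesis using * path_proper[of i h] path_proper[of i h'] by auto
    next
      case False
      have "c u \<in> layer_colors n c i" "c v \<in> layer_colors n c j"
        using * by (auto simp: layer_colors_def)
      then show ?thesis using disj[of i j] * False by auto
    qed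
  qed
  moreover have "r \<le> card (c ` neighborhood (complete_lex_path m n) v)"
    if v_vert: "v \<in> pverts (complete_lex_path m n)" for v
  proof -
    obtain i h where v: "v = (i, h)" "i \<in> {1..m}" "h \<in> {1..n}"
      using v_vert by (auto simp: pverts_complete_lex_path)
    have "finite (c ` ({i} \<times> neighborhood (path_graph n) h))"
      using neighborhood_path_graph_subset finite_subset by blast
    \<comment> \<open>A neighbor on the path supplies the \<open>+ 1\<close> in the assumption on
      \<open>r\<close>.\<close>
    then have "1 \<le> card (c ` ({i} \<times> neighborhood (path_graph n) h))"
      using neighborhood_path_graph_nonempty[OF n v(3)]
      by (simp add: Suc_le_eq card_gt_0_iff)
    moreover have "(\<Sum>j\<in>{1..m} - {i}. card (layer_colors n c j)) = (\<Sum>j\<in>{1..m} - {i}. a j)"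
      by (intro sum.cong) (auto simp: layer)
    ultimately show ?thesis
      using r[OF v(2)] card_layer_colors_image_neighborhood[OF disj v(2,3)] v(1) by simp
  qed
  ultimately show ?thesis
    unfolding dynamic_coloring_def by (intro exI[of _ c]) fastforce
qed

section \<open>Lower bound for large \<open>r\<close>\<close>

lemma dynamic_coloring_card_verts_le:
  assumes col: "dynamic_coloring r k (complete_lex_path m n) c"
    and "m \<ge> 2" and "n \<ge> 1" and r: "max_degree (complete_lex_path m n) \<le> r"
  shows "m * n \<le> k"
proof -
  let ?G = "complete_lex_path m n"
  interpret pair_graph ?G by (rule pair_graph_complete_lex_path)
  \<comment> \<open>With \<open>r \<ge> \<Delta>\<close> a vertex must see as many colors as it has
    neighbors.\<close>
  have nbh_inj: "inj_on c (neighborhood ?G v)" if v: "v \<in> pverts ?G" for v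
  proof -
    have fin: "finite (neighborhood ?G v)"
      by (rule finite_subset[OF _ pair_finite_verts]) (auto simp: neighborhood_def dest: in_arcsD2)
    have "out_degree (with_proj ?G) v \<le> r"
      using out_degree_le_max_degree[OF pair_graph_complete_lex_path v] r by simp
    then have "card (neighborhood ?G v) \<le> card (c ` neighborhood ?G v)"
      using col v unfolding dynamic_coloring_def out_degree_eq_card_neighborhood by fastforce
    then show ?thesis
      using fin card_image_le[OF fin, of c] by (intro eq_card_imp_inj_on) auto
  qed
  have "inj_on c (pverts ?G)"
  proof (rule inj_onI)
    fix u v assume uv: "u \<in> pverts ?G" "v \<in> pverts ?G" "c u = c v"
    then obtain i h j h' where *: "u = (i, h)" "v = (j, h')" "i \<in> {1..m}" "j \<in> {1..m}"
      "h \<in> {1..n}" "h' \<in> {1..n}"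
      by (auto simp: pverts_complete_lex_path)
    have "layer_colors n c i \<inter> layer_colors n c j = {}" if "i \<noteq> j"
      using col * that proper_layer_colors_disjoint[of m n c i j]
      by (auto simp: dynamic_coloring_def)
    moreover have "c u \<in> layer_colors n c i" "c u \<in> layer_colors n c j"
      using * uv(3) unfolding layer_colors_def by (blast, metis SigmaI imageI singletonI)
    ultimately have ij: "i = j" by blast
    \<comment> \<open>Two vertices of the same copy have the common neighbor \<open>(l, 1)\<close>
      in any other copy \<open>l\<close>.\<close>
    obtain l where l: "l \<in> {1..m}" "l \<noteq> i"
      using assms(2) by (intro that[of "if i = 1 then 2 else 1"]) (auto split: if_splits)
    have "u \<in> neighborhood ?G (l, 1)" "v \<in> neighborhood ?G (l, 1)"
      using * ij l assms(3) by (auto simp: neighborhood_complete_lex_path)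
    moreover have "(l, 1) \<in> pverts ?G"
      using l assms(3) by (simp add: pverts_complete_lex_path)
    ultimately show "u = v"
      using nbh_inj uv(3) by (meson inj_onD)
  qed
  then have "card (pverts ?G) \<le> card {1..k}"
    using col by (intro card_inj_on_le[of c]) (auto simp: dynamic_coloring_def)
  then show ?thesis
    by (simp add: pverts_complete_lex_path card_cartesian_product)
qed

section \<open>The three ranges of \<open>r\<close>\<close>

lemma dynamic_chromatic_number_small:
  assumes "m \<ge> 1" and "n \<ge> 2" and "r \<le> 2 * m - 1"
  shows "dynamic_chromatic_number r (complete_lex_path m n) = 2 * m"
proof (rule dynamic_chromatic_number_eqI)
  show "\<exists>c. dynamic_coloring r (2 * m) (complete_lex_path m n) c"
    \<comment> \<open>With all sizes 2, every vertex sees at least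
      \<open>2 * (m - 1) + 1 = 2 * m - 1\<close> colors.\<close>
    using dynamic_coloring_with_layer_sizes_exists[of m "\<lambda>_. 2" n r] assms by (simp add: mult.commute)
next
  fix l c assume col: "dynamic_coloring r l (complete_lex_path m n) c"
  have "2 * m = (\<Sum>i\<in>{1..m}. 2)" by simp
  also have "\<dots> \<le> (\<Sum>i\<in>{1..m}. card (layer_colors n c i))"
    using dynamic_coloring_two_le_layer_colors[OF col assms(2)] by (intro sum_mono)
  also have "\<dots> \<le> l" by (rule dynamic_coloring_sum_layer_colors_le[OF col])
  finally show "2 * m \<le> l" .
qed

text \<open>Outside each copy there must be at least \<open>r - 1\<close> colors, so the total is at
  least \<open>r - 1\<close> plus the largest size. With \<open>s\<close> the quotient, averaging
  forces a size of at least \<open>s + 3\<close>, and sizes up to \<open>s + 3\<close>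
  suffice.\<close>

lemma dynamic_chromatic_number_medium:
  assumes "m \<ge> 2" and "n \<ge> 2" and "2 * m \<le> r" and "r \<le> min_degree (complete_lex_path m n)"
  shows "dynamic_chromatic_number r (complete_lex_path m n) = r + 2 + (r - 2 * m) div (m - 1)"
proof (rule dynamic_chromatic_number_eqI)
  define s where "s = (r - 2 * m) div (m - 1)"
  obtain p where p: "m = Suc p" "p \<ge> 1" using assms(1) by (cases m) auto
  have s_le: "p * s + 2 * m \<le> r"
  proof -
    have "p * s \<le> r - 2 * m" using p(1) by (simp add: s_def)
    then show ?thesis using assms(3) by linarith
  qed
  have s_gt: "r < p * s + p + 2 * m"
    using dividend_less_div_times[of p "r - 2 * m"] p by (simp add: s_def mult.commute)
  have "\<exists>c. dynamic_coloring r (r + 2 + s) (complete_lex_path m n) c"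
  proof -
    have "r \<le> p * n + 1"
      using min_degree_complete_lex_path_le[of m n] assms p by simp
    \<comment> \<open>Since \<open>m = p + 1\<close>,
      \<open>p * (s + 2) = p * s + 2 * m - 2 \<le> r - 2 \<le> p * n - 1\<close>.\<close>
    then have "p * (s + 2) < p * n" using s_le p by (simp add: algebra_simps)
    then have "s + 2 < n" by (metis nat_mult_less_cancel_disj)
    then have s_n: "s + 3 \<le> n" by simp
    \<comment> \<open>The cap \<open>s + 3\<close> leaves at least \<open>r - 1\<close> of the total
      for the other copies. The total fits under \<open>m * (s + 3)\<close> because
      \<open>s_gt\<close> gives \<open>r \<le> p * s + 3 * p + 1\<close>.\<close>
    have "\<exists>a. (\<forall>i\<in>{1..m}. 2 \<le> a i \<and> a i \<le> s + 3) \<and> (\<Sum>i\<in>{1..m}. a i) = r + 2 + s"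
      using s_gt assms(3) p by (intro exists_bounded_summands) (auto simp: algebra_simps)
    then obtain a where a: "\<And>i. i \<in> {1..m} \<Longrightarrow> 2 \<le> a i \<and> a i \<le> s + 3"
      "(\<Sum>i\<in>{1..m}. a i) = r + 2 + s" by blast
    have "r \<le> (\<Sum>j\<in>{1..m} - {i}. a j) + 1" if "i \<in> {1..m}" for i
      using a(2) a(1)[OF that] sum.remove[of "{1..m}" i a] that by simp
    then show ?thesis
      using dynamic_coloring_with_layer_sizes_exists[of m a n r] a s_n assms(2) by fastforce
  qed
  then show "\<exists>c. dynamic_coloring r (r + 2 + (r - 2 * m) div (m - 1)) (complete_lex_path m n) c"
    by (simp add: s_def)
  fix l c assume col: "dynamic_coloring r l (complete_lex_path m n) c"
  let ?a = "\<lambda>i. card (layer_colors n c i)"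
  have others: "r \<le> (\<Sum>j\<in>{1..m} - {i}. ?a j) + 1" if "i \<in> {1..m}" for i
    using dynamic_coloring_le_sum_other_layers[OF col assms(2) that assms(4)] .
  obtain i where i: "i \<in> {1..m}" "s + 3 \<le> ?a i"
  proof (rule ccontr)
    assume "\<not> thesis"
    then have "\<forall>i\<in>{1..m}. \<not> s + 3 \<le> ?a i" using that by blast
    then have small: "?a i \<le> s + 2" if "i \<in> {1..m}" for i using that by fastforce
    \<comment> \<open>If all sizes were at most \<open>s + 2\<close>, the copies other than the
      first would have at most \<open>p * (s + 2) \<le> r - 2\<close> colors, one too few.\<close>
    have "(\<Sum>j\<in>{1..m} - {1}. ?a j) \<le> of_nat (card ({1..m} - {1})) * (s + 2)"
      by (rule sum_bounded_above) (use small in auto)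
    then have "(\<Sum>j\<in>{1..m} - {1}. ?a j) \<le> p * (s + 2)" using p by simp
    then show False using others[of 1] s_le p by (simp add: algebra_simps)
  qed
  have "r + 2 + s \<le> (\<Sum>j\<in>{1..m}. ?a j)"
    using others[OF i(1)] i(2) sum.remove[of "{1..m}" i ?a] i(1) by simp
  also have "\<dots> \<le> l" by (rule dynamic_coloring_sum_layer_colors_le[OF col])
  finally show "r + 2 + (r - 2 * m) div (m - 1) \<le> l" by (simp add: s_def)
qed

lemma dynamic_chromatic_number_large:
  assumes "m \<ge> 2" and "n \<ge> 1" and "max_degree (complete_lex_path m n) \<le> r"
  shows "dynamic_chromatic_number r (complete_lex_path m n) = m * n"
proof (rule dynamic_chromatic_number_eqI)
  show "\<exists>c. dynamic_coloring r (m * n) (complete_lex_path m n) c"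
    using dynamic_coloring_card_verts_exists[OF pair_graph_complete_lex_path, of r m n]
    by (simp add: pverts_complete_lex_path card_cartesian_product)
qed (rule dynamic_coloring_card_verts_le[OF _ assms])

theorem theorem5:
  fixes r m n :: nat and G :: "(nat \<times> nat) pair_pre_digraph"
  assumes "r \<ge> 1" and "m \<ge> 3" and "n \<ge> 3"
    and "G = lex_product (complete_graph m) (path_graph n)"
  shows "(1 \<le> r \<and> r \<le> 2 * m - 1 \<longrightarrow> dynamic_chromatic_number r G = 2 * m) \<and>
    (2 * m \<le> r \<and> r \<le> min_degree G \<longrightarrow>
       int (dynamic_chromatic_number r G) =
         int r + 2 + \<lfloor>(real r - 2 * real m) / (real m - 1)\<rfloor>) \<and>
    (max_degree G \<le> r \<longrightarrow> dynamic_chromatic_number r G = m * n)"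
proof (intro conjI impI; (elim conjE)?)
  assume "r \<le> 2 * m - 1"
  then show "dynamic_chromatic_number r G = 2 * m"
    using dynamic_chromatic_number_small assms by simp
next
  assume r: "2 * m \<le> r" "r \<le> min_degree G"
  \<comment> \<open>By \<open>2 * m \<le> r\<close> and \<open>m \<ge> 3\<close> the natural-number
    subtractions do not truncate, so the real floor is a natural-number quotient.\<close>
  have "\<lfloor>(real r - 2 * real m) / (real m - 1)\<rfloor> = \<lfloor>real (r - 2 * m) / real (m - 1)\<rfloor>"
    using r(1) assms(2) by (simp add: of_nat_diff)
  also have "\<dots> = int ((r - 2 * m) div (m - 1))"
    by (simp add: floor_divide_of_nat_eq)
  finally show "int (dynamic_chromatic_number r G) =
      int r + 2 + \<lfloor>(real r - 2 * real m) / (real m - 1)\<rfloor>"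
    using dynamic_chromatic_number_medium[of m n r] r assms by simp
next
  assume "max_degree G \<le> r"
  then show "dynamic_chromatic_number r G = m * n"
    using dynamic_chromatic_number_large assms by simp
qed

end
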